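(* Let $X$ be a quasi-compact and sequentially compact topological space, let $u=(u_p)_{p\in I}$ and $v=(v_p)_{p\in I}$ be two families of continuous functions $X\to\mathbb{R}$ indexed by a set $I$, and let $R$ be the preorder on $X$ given by \[ xRy \iff u_p(x)\leq u_p(y)\ \text{ and }\ v_p(x)\geq v_p(y)\ \text{ for all } p\in I . \] Then for any element $x\in X$ there exists an $R$-maximal element $y\in X$ with $xRy$.
   Context: A topological space $X$ is quasi-compact if every open covering of $X$ contains a finite open covering (no Hausdorff assumption). It is sequentially compact if every infinite sequence of elements of $X$ has a converging subsequence. The symmetric part of $R$ is $E=\{(x,y)\in X^2 : u_p(x)=u_p(y) \text{ and } v_p(x)=v_p(y)\text{ for all }p\in I\}$ and the asymmetric part is $F=R\setminus E$; thus $xFy$ means that $xRy$ and either there is $p_0\in I$ with $u_{p_0}(x)<u_{p_0}(y)$ or there is $q_0\in I$ with $v_{q_0}(x)>v_{q_0}(y)$. An element $y\in X$ is $R$-maximal if there is no $z\in X$ with $yFz$. *)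

theory Defs
  imports "HOL-Analysis.Analysis"
begin

text \<open>The library's \<^const>\<open>seq_compact\<close> only covers type-class topologies; this is the
  notion for a space given as an \<^typ>\<open>'a topology\<close>.\<close>

definition seq_compact_space :: "'a topology \<Rightarrow> bool" where
  "seq_compact_space X \<longleftrightarrow>
     (\<forall>f :: nat \<Rightarrow> 'a. range f \<subseteq> topspace X \<longrightarrow>
        (\<exists>l r. strict_mono r \<and> limitin X (f \<circ> r) l sequentially))"

text \<open>Relations on the carrier set \<open>S\<close>, as sets of pairs. Only the values \<open>u p\<close>, \<open>v p\<close> with
  \<open>p \<in> I\<close>, at points of \<open>S\<close>, matter.\<close>

definition pref_rel ::
    "'a set \<Rightarrow> 'i set \<Rightarrow> ('i \<Rightarrow> 'a \<Rightarrow> real) \<Rightarrow> ('i \<Rightarrow> 'a \<Rightarrow> real) \<Rightarrow> 'a rel" where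
  "pref_rel S I u v =
     {(x, y) \<in> S \<times> S. \<forall>p\<in>I. u p x \<le> u p y \<and> v p x \<ge> v p y}"

definition sym_part ::
    "'a set \<Rightarrow> 'i set \<Rightarrow> ('i \<Rightarrow> 'a \<Rightarrow> real) \<Rightarrow> ('i \<Rightarrow> 'a \<Rightarrow> real) \<Rightarrow> 'a rel" where
  "sym_part S I u v =
     {(x, y) \<in> S \<times> S. \<forall>p\<in>I. u p x = u p y \<and> v p x = v p y}"

definition asym_part ::
    "'a set \<Rightarrow> 'i set \<Rightarrow> ('i \<Rightarrow> 'a \<Rightarrow> real) \<Rightarrow> ('i \<Rightarrow> 'a \<Rightarrow> real) \<Rightarrow> 'a rel" where
  "asym_part S I u v = pref_rel S I u v - sym_part S I u v"

definition pref_maximal ::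
    "'a set \<Rightarrow> 'i set \<Rightarrow> ('i \<Rightarrow> 'a \<Rightarrow> real) \<Rightarrow> ('i \<Rightarrow> 'a \<Rightarrow> real) \<Rightarrow> 'a \<Rightarrow> bool" where
  "pref_maximal S I u v y \<longleftrightarrow> y \<in> S \<and> \<not> (\<exists>z\<in>S. (y, z) \<in> asym_part S I u v)"

lemma preorder_on_pref_rel: "preorder_on S (pref_rel S I u v)"
  unfolding preorder_on_def refl_on_def trans_def pref_rel_def
  by (auto intro: order_trans)

lemma asym_part_iff:
  "(x, y) \<in> asym_part S I u v \<longleftrightarrow>
     (x, y) \<in> pref_rel S I u v \<and> ((\<exists>p\<in>I. u p x < u p y) \<or> (\<exists>q\<in>I. v q x > v q y))"
  unfolding asym_part_def pref_rel_def sym_part_def by force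

end

theory Submission
  imports Defs
begin

text \<open>Every set \<open>{z. y R z}\<close> of elements above a point is cut out by weak inequalities between
  continuous functions and constants, hence is closed. Along an \<open>R\<close>-chain these closed sets are
  nested and nonempty, so quasi-compactness gives a point common to all of them, which is an upper
  bound of the chain. Zorn's lemma, applied above \<open>x\<close>, then yields an element \<open>y\<close> such that every
  \<open>z\<close> with \<open>y R z\<close> also satisfies \<open>z R y\<close>; such a pair belongs to the symmetric part, so \<open>y\<close> is
  \<open>R\<close>-maximal.\<close>

lemma compact_space_chain_Inter_nonempty:
  assumes "compact_space X"
    and "\<And>C. C \<in> \<C> \<Longrightarrow> closedin X C"
    and "{} \<notin> \<C>"
    and chain: "subset.chain UNIV \<C>"
  shows "\<Inter>\<C> \<noteq> {}"
proof -
  \<comment> \<open>A finite nonempty chain contains its own intersection, so the finite intersection property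
    reduces to nonemptiness of the members.\<close>
  have "\<Inter>\<F> \<noteq> {}" if "finite \<F>" "\<F> \<subseteq> \<C>" for \<F>
  proof (cases "\<F> = {}")
    case False
    have "subset.chain UNIV \<F>"
      using chain that(2) by (auto simp: subset_chain_def)
    then have "\<Inter>\<F> \<in> \<F>"
      by (rule Inter_in_chain[OF that(1) False])
    then show ?thesis
      using that(2) assms(3) by (metis subsetD)
  qed simp
  with assms(2) show ?thesis
    by (intro assms(1)[unfolded compact_space_fip, rule_format]) auto
qed

text \<open>Zorn's lemma for inclusion speaks of a partial order, while antisymmetry may fail here.
  Replacing a point \<open>y\<close> by its lower set \<open>r\<inverse> `` {y}\<close> identifies exactly the equivalent points, and
  turns \<open>r\<close> into inclusion of lower sets.\<close>

lemma compact_space_preorder_maximal_above: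
  assumes comp: "compact_space X"
    and preo: "preorder_on (topspace X) r"
    and closed: "\<And>y. y \<in> topspace X \<Longrightarrow> closedin X (r `` {y})"
    and x: "x \<in> topspace X"
  shows "\<exists>y. (x, y) \<in> r \<and> (\<forall>z. (y, z) \<in> r \<longrightarrow> (z, y) \<in> r)"
proof -
  have sub: "r \<subseteq> topspace X \<times> topspace X"
    and refl: "\<And>y. y \<in> topspace X \<Longrightarrow> (y, y) \<in> r"
    and trans: "\<And>a b c. (a, b) \<in> r \<Longrightarrow> (b, c) \<in> r \<Longrightarrow> (a, c) \<in> r"
    using preo unfolding preorder_on_def refl_on_def trans_def by blast+
  define low where "low y = r\<inverse> `` {y}" for y
  have low_iff: "low y \<subseteq> low z \<longleftrightarrow> (y, z) \<in> r" if "y \<in> topspace X" for y z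
  proof
    show "(y, z) \<in> r" if "low y \<subseteq> low z"
      using that refl[OF \<open>y \<in> topspace X\<close>] unfolding low_def by blast
    show "low y \<subseteq> low z" if "(y, z) \<in> r"
      using trans[OF _ that] unfolding low_def by blast
  qed
  define \<A> where "\<A> = low ` (r `` {x})"
  have bound: "\<exists>U\<in>\<A>. \<forall>L\<in>\<C>. L \<subseteq> U" if chain: "subset.chain \<A> \<C>" for \<C>
  proof -
    \<comment> \<open>Including \<open>x\<close> among the points keeps the bound above \<open>x\<close> even if the chain is empty.\<close>
    define B where "B = insert x {y. (x, y) \<in> r \<and> low y \<in> \<C>}"
    have B: "B \<subseteq> topspace X"
      using sub x unfolding B_def by blast
    have total: "(a, b) \<in> r \<or> (b, a) \<in> r" if ab: "a \<in> B" "b \<in> B" for a b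
    proof (cases "a = x \<or> b = x")
      case True
      then show ?thesis
        using ab refl[OF x] unfolding B_def by blast
    next
      case False
      then have "low a \<subseteq> low b \<or> low b \<subseteq> low a"
        using ab chain unfolding B_def subset_chain_def by blast
      then show ?thesis
        using low_iff ab B by (meson subsetD)
    qed
    have "\<Inter>((\<lambda>y. r `` {y}) ` B) \<noteq> {}"
    proof (rule compact_space_chain_Inter_nonempty[OF comp])
      show "closedin X C" if "C \<in> (\<lambda>y. r `` {y}) ` B" for C
        using that closed B by blast
      show "{} \<notin> (\<lambda>y. r `` {y}) ` B"
        using refl B by blast
      have "r `` {a} \<subseteq> r `` {b} \<or> r `` {b} \<subseteq> r `` {a}" if "a \<in> B" "b \<in> B" for a b
      proof -
        from total[OF that] show ?thesis
        proof
          assume "(a, b) \<in> r"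
          then show ?thesis
            using trans[of a b] by blast
        next
          assume "(b, a) \<in> r"
          then show ?thesis
            using trans[of b a] by blast
        qed
      qed
      then show "subset.chain UNIV ((\<lambda>y. r `` {y}) ` B)"
        unfolding subset_chain_def by blast
    qed
    then obtain m where m: "\<And>y. y \<in> B \<Longrightarrow> (y, m) \<in> r"
      by blast
    have "(x, m) \<in> r"
      using m unfolding B_def by blast
    moreover have "L \<subseteq> low m" if "L \<in> \<C>" for L
    proof -
      have "L \<in> \<A>"
        using chain that unfolding subset_chain_def by blast
      then obtain y where y: "(x, y) \<in> r" "L = low y"
        unfolding \<A>_def by blast
      then have "y \<in> B"
        using that unfolding B_def by blast
      then show ?thesis
        using m low_iff y(2) B by (metis subsetD)
    qed
    ultimately show ?thesis
      unfolding \<A>_def by blast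
  qed
  obtain M where M: "M \<in> \<A>" "\<And>L. L \<in> \<A> \<Longrightarrow> M \<subseteq> L \<Longrightarrow> L = M"
    using subset_Zorn[of \<A>, OF bound] by blast
  then obtain y where y: "(x, y) \<in> r" "M = low y"
    unfolding \<A>_def by blast
  have "(z, y) \<in> r" if "(y, z) \<in> r" for z
  proof -
    have yz: "y \<in> topspace X" "z \<in> topspace X"
      using that sub by auto
    have "low z \<in> \<A>"
      using trans[OF y(1) that] unfolding \<A>_def by blast
    moreover have "M \<subseteq> low z"
      using that low_iff[OF yz(1)] y(2) by simp
    ultimately have "low z = low y"
      using M(2) y(2) by simp
    then show ?thesis
      using low_iff[OF yz(2), of y] by simp
  qed
  with y(1) show ?thesis
    by blast
qed

lemma closedin_pref_rel_above:
  assumes "\<And>p. p \<in> I \<Longrightarrow> continuous_map X euclideanreal (u p)"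
    and "\<And>p. p \<in> I \<Longrightarrow> continuous_map X euclideanreal (v p)"
    and "y \<in> topspace X"
  shows "closedin X (pref_rel (topspace X) I u v `` {y})"
proof -
  have eq: "pref_rel (topspace X) I u v `` {y} =
      topspace X \<inter> (\<Inter>p\<in>I. {z \<in> topspace X. u p z \<in> {u p y..}} \<inter> {z \<in> topspace X. v p z \<in> {..v p y}})"
    using assms(3) unfolding pref_rel_def by auto
  have cl: "closedin X ({z \<in> topspace X. u p z \<in> {u p y..}} \<inter> {z \<in> topspace X. v p z \<in> {..v p y}})"
    if "p \<in> I" for p
    using assms(1,2)[OF that]
    by (intro closedin_Int closedin_continuous_map_preimage) auto
  show ?thesis
  proof (cases "I = {}")
    case False
    then show ?thesis
      unfolding eq by (intro closedin_Int[OF closedin_topspace] closedin_INT cl)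
  next
    case True
    then show ?thesis
      unfolding eq by simp
  qed
qed

theorem theorem2p2p6:
  fixes X :: "'a topology" and I :: "'i set" and u v :: "'i \<Rightarrow> 'a \<Rightarrow> real"
  assumes "compact_space X"
    and "seq_compact_space X"
    and "\<And>p. p \<in> I \<Longrightarrow> continuous_map X euclideanreal (u p)"
    and "\<And>p. p \<in> I \<Longrightarrow> continuous_map X euclideanreal (v p)"
    and "x \<in> topspace X"
  shows "\<exists>y\<in>topspace X.
           pref_maximal (topspace X) I u v y \<and> (x, y) \<in> pref_rel (topspace X) I u v"
proof -
  have closed: "closedin X (pref_rel (topspace X) I u v `` {y})" if "y \<in> topspace X" for y
    using assms(3,4) that by (rule closedin_pref_rel_above)
  obtain y where y: "(x, y) \<in> pref_rel (topspace X) I u v"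
    and max: "\<And>z. (y, z) \<in> pref_rel (topspace X) I u v \<Longrightarrow> (z, y) \<in> pref_rel (topspace X) I u v"
    using compact_space_preorder_maximal_above[OF assms(1) preorder_on_pref_rel closed assms(5)]
    by blast
  have "y \<in> topspace X"
    using y unfolding pref_rel_def by blast
  moreover have "(y, z) \<notin> asym_part (topspace X) I u v" for z
  proof
    assume yz: "(y, z) \<in> asym_part (topspace X) I u v"
    then have "(y, z) \<in> pref_rel (topspace X) I u v"
      unfolding asym_part_iff by (rule conjunct1)
    with max[OF this] have "(y, z) \<in> sym_part (topspace X) I u v"
      unfolding pref_rel_def sym_part_def by (auto intro: antisym)
    with yz show False
      unfolding asym_part_def by simp
  qed
  ultimately show ?thesis
    using y unfolding pref_maximal_def by blast
qed

end
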